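(* Let $K\ge 2$ and let $L_1,\dots,L_K\ge 1$ be integers. For $\nu>0$ let $T_{(k_1,l_1),(k_2,l_2)}(\nu)$ denote the first-passage time from state $(k_1,l_1)$ to state $(k_2,l_2)$ of the process $(X_t)_{t\ge0}$ with activation rate $\nu$ on the star-shaped state space $\Omega=\{0\}\cup\{(k,l):1\le l\le L_k,\ 1\le k\le K\}$. Let $k_1\ne k_2$ be in $\{1,\dots,K\}$, and set $L_*:=\max_{j\ne k_2}L_j$ and $K_*:=\{k\ne k_2: L_k=L_*\}$. Then for all integers $0<l_1\le L_{k_1}$ and $0<l_2\le L_{k_2}$, $$\mathbb{E}\,T_{(k_1,l_1),(k_2,l_2)}(\nu)\sim\left(\frac{I_{\{k_1\in K_*\}}}{L_*}+\frac{|K_*|}{L_{k_2}}\right)\nu^{L_*-1},\qquad \nu\to\infty .$$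
   Context: The process $(X_t)_{t\ge0}$ (with parameter $\nu>0$) is the continuous-time Markov process on $\Omega=\{0\}\cup\{(k,l):1\le l\le L_k,\ 1\le k\le K\}$ whose only nonzero transition rates are $q(0,(k,1))=L_k\nu$; $q((k,l),(k,l+1))=(L_k-l)\nu$ for $l=1,\dots,L_k-1$; $q((k,1),0)=1$; $q((k,l),(k,l-1))=l$ for $l=2,\dots,L_k$; $k=1,\dots,K$. (It arises from a CSMA network on a complete $K$-partite interference graph with component sizes $L_1,\dots,L_K$: state $(k,l)$ means that $l$ nodes are active in component $k$, state $0$ that no node is active.) The first-passage time is $T_{(k_1,l_1),(k_2,l_2)}(\nu)=\inf\{t>0:X_t=(k_2,l_2)\}$ given $X_0=(k_1,l_1)$. $I_{\{\cdot\}}$ is the indicator ($1$ if the condition holds, $0$ otherwise). The notation $f(\nu)\sim g(\nu)$ means $\lim_{\nu\to\infty}f(\nu)/g(\nu)=1$. *)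

theory Defs
  imports "HOL-Probability.Probability"
begin

text \<open>
  Transition probabilities \<open>p t x y\<close> on \<open>S\<close> with transition rates \<open>q x y\<close>. Only the
  off-diagonal rates are used: since rows sum to one and \<open>S\<close> is finite, they determine the
  derivative of \<open>p t x x\<close> at \<open>0\<close>.
\<close>

definition transition_function ::
    "'s set \<Rightarrow> ('s \<Rightarrow> 's \<Rightarrow> real) \<Rightarrow> (real \<Rightarrow> 's \<Rightarrow> 's \<Rightarrow> real) \<Rightarrow> bool" where
  "transition_function S q p \<longleftrightarrow>
     finite S \<and>
     (\<forall>t\<ge>0. \<forall>x\<in>S. \<forall>y\<in>S. 0 \<le> p t x y) \<and>
     (\<forall>t\<ge>0. \<forall>x\<in>S. (\<Sum>y\<in>S. p t x y) = 1) \<and>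
     (\<forall>x\<in>S. \<forall>y\<in>S. p 0 x y = (if x = y then 1 else 0)) \<and>
     (\<forall>s\<ge>0. \<forall>t\<ge>0. \<forall>x\<in>S. \<forall>y\<in>S. p (s + t) x y = (\<Sum>z\<in>S. p s x z * p t z y)) \<and>
     (\<forall>x\<in>S. \<forall>y\<in>S. x \<noteq> y \<longrightarrow> ((\<lambda>t. p t x y / t) \<longlongrightarrow> q x y) (at_right 0))"

text \<open>
  \<open>X\<close> is a time-homogeneous Markov process with state space \<open>S\<close>, rates \<open>q\<close> and initial state
  \<open>x0\<close>, with almost surely right-continuous paths (for the discrete topology on \<open>S\<close>). In the
  Markov property, \<open>J\<close> is the set of observation times up to and including the present \<open>t\<close>,
  and \<open>a\<close> gives the observed states.
\<close>

definition markov_process ::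
    "'w measure \<Rightarrow> 's set \<Rightarrow> ('s \<Rightarrow> 's \<Rightarrow> real) \<Rightarrow> 's \<Rightarrow> (real \<Rightarrow> 'w \<Rightarrow> 's) \<Rightarrow> bool" where
  "markov_process M S q x0 X \<longleftrightarrow>
     prob_space M \<and>
     (\<forall>t\<ge>0. X t \<in> measurable M (count_space S)) \<and>
     (AE \<omega> in M. X 0 \<omega> = x0) \<and>
     (AE \<omega> in M. \<forall>t\<ge>0. \<forall>\<^sub>F s in at_right t. X s \<omega> = X t \<omega>) \<and>
     (\<exists>p. transition_function S q p \<and>
        (\<forall>t\<ge>0. \<forall>h\<ge>0. \<forall>J a. \<forall>y\<in>S.
           finite J \<and> J \<subseteq> {0..t} \<and> t \<in> J \<and> \<P>(\<omega> in M. \<forall>s\<in>J. X s \<omega> = a s) > 0 \<longrightarrow>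
           \<P>(\<omega> in M. X (t + h) \<omega> = y \<bar> \<forall>s\<in>J. X s \<omega> = a s) = p h (a t) y))"

text \<open>The value is \<open>\<infinity>\<close> if \<open>y\<close> is never hit.\<close>

definition first_passage_time :: "(real \<Rightarrow> 'w \<Rightarrow> 's) \<Rightarrow> 's \<Rightarrow> 'w \<Rightarrow> ennreal" where
  "first_passage_time X y \<omega> = (INF t\<in>{t. 0 < t \<and> X t \<omega> = y}. ennreal t)"

definition mean_first_passage_time ::
    "'w measure \<Rightarrow> (real \<Rightarrow> 'w \<Rightarrow> 's) \<Rightarrow> 's \<Rightarrow> ennreal" where
  "mean_first_passage_time M X y = (\<integral>\<^sup>+\<omega>. first_passage_time X y \<omega> \<partial>M)"

datatype state = Zero | Active nat nat

definition state_space :: "nat \<Rightarrow> (nat \<Rightarrow> nat) \<Rightarrow> state set" where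
  "state_space K L = {Zero} \<union> {Active k l | k l. k \<in> {1..K} \<and> l \<in> {1..L k}}"

text \<open>Meaningful for pairs of distinct states in \<open>state_space K L\<close> only.\<close>

fun rate :: "(nat \<Rightarrow> nat) \<Rightarrow> real \<Rightarrow> state \<Rightarrow> state \<Rightarrow> real" where
  "rate L \<nu> Zero Zero = 0"
| "rate L \<nu> Zero (Active k l) = (if l = 1 then real (L k) * \<nu> else 0)"
| "rate L \<nu> (Active k l) Zero = (if l = 1 then 1 else 0)"
| "rate L \<nu> (Active k l) (Active k' l') =
     (if k' \<noteq> k then 0
      else if l' = l + 1 then (real (L k) - real l) * \<nu>
      else if l = l' + 1 then real l
      else 0)"

definition L_star :: "nat \<Rightarrow> (nat \<Rightarrow> nat) \<Rightarrow> nat \<Rightarrow> nat" where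
  "L_star K L k2 = Max (L ` ({1..K} - {k2}))"

definition K_star :: "nat \<Rightarrow> (nat \<Rightarrow> nat) \<Rightarrow> nat \<Rightarrow> nat set" where
  "K_star K L k2 = {k \<in> {1..K} - {k2}. L k = L_star K L k2}"

end

theory Submission
  imports Defs
begin

text \<open>
  The mean first-passage time can be computed exactly for every \<open>\<nu>\<close>, and the asymptotics is
  then read off from the formula.

  For a finite-state process, the mean hitting time of \<open>y\<close> is the value at the initial state of
  any nonnegative function \<open>h\<close> with \<open>h y = 0\<close> on which the generator takes the value \<open>-1\<close>
  outside \<open>y\<close> (\<open>mean_first_passage_time_eqI\<close>). The reason is that \<open>h (X t) + t\<close>, stopped at the
  hitting time, should be a martingale. Since the process is given only by its finite-dimensional
  distributions and its right-continuous paths, the argument is carried out on the grids of mesh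
  \<open>\<delta> = (1/2)^n\<close>: the chain observed on the grid and killed at \<open>y\<close> loses \<open>\<delta> + o(\<delta>)\<close> of the
  mean of \<open>h\<close> per step, so that the mean number of steps is \<open>h x0 / \<delta>\<close> up to a factor tending to
  one (\<open>killed_chain_bounds\<close>, \<open>grid_hitting_time_mean_bounds\<close>). As the grids are refined, their
  hitting times decrease to the true one by right-continuity, and monotone convergence applies.

  On the star, \<open>h\<close> is a sum of mean passage times between neighbours. Moving inwards on a branch
  of length \<open>n\<close>, the mean time from \<open>l\<close> to \<open>l - 1\<close> is \<open>descent n \<nu> l\<close>, of order \<open>\<nu>^(n - l)\<close>
  and with leading coefficient \<open>1/n\<close> for \<open>l = 1\<close>. Moving outwards on the target branch, the mean
  time from \<open>l\<close> to \<open>l + 1\<close> is given by \<open>ascent\<close>, and its value at the centre accounts for all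
  unsuccessful visits to the other branches. After division by \<open>\<nu>^(L_* - 1)\<close> two terms survive.
  The last inward step on the initial branch contributes \<open>1/L_*\<close> if that branch has length \<open>L_*\<close>.
  The step out of the centre contributes \<open>|K_*|/L_k2\<close>: before the target branch is chosen, each
  branch in \<open>K_*\<close> is visited \<open>L_*/L_k2\<close> times on average, for a time \<open>\<nu>^(L_* - 1)/L_*\<close> each.
\<close>

section \<open>Mean absorption time of a killed chain\<close>

text \<open>
  The mean \<open>a k\<close> of \<open>h\<close> over the mass that survives \<open>k\<close> steps decreases in step \<open>k\<close> by at least
  \<open>c\<close> and at most \<open>C\<close> times that mass. These decreases sum to at most \<open>a 0\<close>, which makes the
  surviving masses summable; hence \<open>a k\<close> tends to \<open>0\<close> and the decreases sum to exactly \<open>a 0\<close>.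
\<close>

lemma killed_chain_bounds:
  fixes w :: "nat \<Rightarrow> 's \<Rightarrow> real"
  assumes fin: "finite S"
    and w0: "\<And>k x. x \<in> S \<Longrightarrow> 0 \<le> w k x"
    and step: "\<And>k z. z \<in> S \<Longrightarrow> w (Suc k) z = (\<Sum>x\<in>S. w k x * P x z)"
    and h0: "\<And>x. x \<in> S \<Longrightarrow> 0 \<le> h x"
    and c: "0 < c"
    and lo: "\<And>x. x \<in> S \<Longrightarrow> c \<le> h x - (\<Sum>z\<in>S. P x z * h z)"
    and up: "\<And>x. x \<in> S \<Longrightarrow> h x - (\<Sum>z\<in>S. P x z * h z) \<le> C"
  shows "summable (\<lambda>k. \<Sum>x\<in>S. w k x)"
    and "c * (\<Sum>k. \<Sum>x\<in>S. w k x) \<le> (\<Sum>x\<in>S. w 0 x * h x)"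
    and "(\<Sum>x\<in>S. w 0 x * h x) \<le> C * (\<Sum>k. \<Sum>x\<in>S. w k x)"
proof -
  define s where "s k = (\<Sum>x\<in>S. w k x)" for k
  define a where "a k = (\<Sum>x\<in>S. w k x * h x)" for k
  have a0: "0 \<le> a k" for k
    unfolding a_def by (intro sum_nonneg mult_nonneg_nonneg w0 h0)
  have s0: "0 \<le> s k" for k
    unfolding s_def by (intro sum_nonneg w0)
  have a_Suc: "a (Suc k) = (\<Sum>x\<in>S. w k x * (\<Sum>z\<in>S. P x z * h z))" for k
  proof -
    have "a (Suc k) = (\<Sum>z\<in>S. (\<Sum>x\<in>S. w k x * P x z) * h z)"
      unfolding a_def by (simp add: step)
    also have "\<dots> = (\<Sum>z\<in>S. \<Sum>x\<in>S. w k x * (P x z * h z))"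
      by (simp add: sum_distrib_right mult.assoc)
    also have "\<dots> = (\<Sum>x\<in>S. w k x * (\<Sum>z\<in>S. P x z * h z))"
      unfolding sum_distrib_left by (rule sum.swap)
    finally show ?thesis .
  qed
  have diff: "a k - a (Suc k) = (\<Sum>x\<in>S. w k x * (h x - (\<Sum>z\<in>S. P x z * h z)))" for k
    unfolding a_Suc unfolding a_def by (simp add: sum_subtractf right_diff_distrib)
  have ge: "s k * c \<le> a k - a (Suc k)" for k
    unfolding diff s_def sum_distrib_right by (intro sum_mono mult_left_mono lo w0)
  have le: "a k - a (Suc k) \<le> s k * C" for k
    unfolding diff s_def sum_distrib_right by (intro sum_mono mult_left_mono up w0)
  have tele: "(\<Sum>k<n. a k - a (Suc k)) = a 0 - a n" for n
    by (rule sum_lessThan_telescope')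
  have psum: "(\<Sum>k<n. s k) * c \<le> a 0" for n
  proof -
    have "(\<Sum>k<n. s k) * c \<le> (\<Sum>k<n. a k - a (Suc k))"
      unfolding sum_distrib_right by (intro sum_mono ge)
    then show ?thesis using tele[of n] a0[of n] by linarith
  qed
  have "(\<Sum>k<n. s k) \<le> a 0 / c" for n
    using psum[of n] c by (simp add: pos_le_divide_eq)
  then have summ: "summable s"
    using s0 by (intro summableI_nonneg_bounded)
  then show "summable (\<lambda>k. \<Sum>x\<in>S. w k x)"
    unfolding s_def .
  have lim: "(\<lambda>n. \<Sum>k<n. s k) \<longlonglongrightarrow> suminf s"
    by (rule summable_LIMSEQ[OF summ])
  have "suminf s * c \<le> a 0"
    by (rule LIMSEQ_le_const2[OF tendsto_mult_right[OF lim]]) (use psum in blast)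
  then show "c * (\<Sum>k. \<Sum>x\<in>S. w k x) \<le> (\<Sum>x\<in>S. w 0 x * h x)"
    by (simp add: s_def[abs_def] a_def mult.commute)
  define H where "H = (\<Sum>x\<in>S. h x)"
  have aH: "a n \<le> s n * H" for n
    unfolding a_def s_def sum_distrib_right H_def
    by (intro sum_mono mult_left_mono w0 member_le_sum fin) (auto intro: h0)
  have "a \<longlonglongrightarrow> 0"
  proof (rule tendsto_sandwich[OF _ _ tendsto_const])
    show "(\<lambda>n. s n * H) \<longlonglongrightarrow> 0"
      using tendsto_mult_right[OF summable_LIMSEQ_zero[OF summ], of H] by simp
  qed (use a0 aH in auto)
  then have "(\<lambda>n. a 0 - a n) \<longlonglongrightarrow> a 0 - 0"
    by (intro tendsto_intros)
  moreover have "a 0 - a n \<le> (\<Sum>k<n. s k) * C" for n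
    unfolding tele[symmetric] sum_distrib_right by (intro sum_mono le)
  ultimately have "a 0 - 0 \<le> suminf s * C"
    by (intro LIMSEQ_le[OF _ tendsto_mult_right[OF lim]]) auto
  then show "(\<Sum>x\<in>S. w 0 x * h x) \<le> C * (\<Sum>k. \<Sum>x\<in>S. w k x)"
    by (simp add: s_def[abs_def] a_def mult.commute)
qed

section \<open>Hitting times on a grid\<close>

lemma sets_Collect_count_space:
  assumes "Y \<in> measurable M (count_space S)"
  shows "{\<omega>\<in>space M. Y \<omega> \<in> B} \<in> sets M"
proof -
  have "Y -` (B \<inter> S) \<inter> space M \<in> sets M"
    by (rule measurable_sets[OF assms]) simp
  also have "Y -` (B \<inter> S) \<inter> space M = {\<omega>\<in>space M. Y \<omega> \<in> B}"
    using measurable_space[OF assms] by auto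
  finally show ?thesis .
qed

text \<open>
  The Markov property conditions on exact trajectories; survival up to time \<open>t\<close> is a finite
  disjoint union of such trajectories, so that it passes to the event of not having been killed.
\<close>

lemma (in prob_space) markov_event:
  assumes meas: "\<And>s. s \<in> J \<union> {u} \<Longrightarrow> X s \<in> measurable M (count_space S)"
    and fin: "finite S" "finite J" and B: "B \<subseteq> S" and t: "t \<in> J"
    and mk: "\<And>a. 0 < \<P>(\<omega> in M. \<forall>s\<in>J. X s \<omega> = a s) \<Longrightarrow>
         \<P>(\<omega> in M. X u \<omega> = y \<bar> \<forall>s\<in>J. X s \<omega> = a s) = r (a t)"
  shows "\<P>(\<omega> in M. (\<forall>s\<in>J. X s \<omega> \<in> B) \<and> X u \<omega> = y) =
    (\<Sum>x\<in>B. \<P>(\<omega> in M. (\<forall>s\<in>J. X s \<omega> \<in> B) \<and> X t \<omega> = x) * r x)"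
proof -
  have finB: "finite B" using B fin finite_subset by blast
  define C where "C a = {\<omega>\<in>space M. \<forall>s\<in>J. X s \<omega> = a s}" for a
  have C[measurable]: "C a \<in> sets M" for a
  proof -
    have "{\<omega>\<in>space M. X s \<omega> = a s} \<in> sets M" if "s \<in> J" for s
      using sets_Collect_count_space[OF meas[of s], of "{a s}"] that by simp
    then show ?thesis
      unfolding C_def using fin by (intro sets.sets_Collect_finite_All) auto
  qed
  have split: "prob {\<omega>\<in>space M. (\<forall>s\<in>J. X s \<omega> \<in> B) \<and> X v \<omega> = b} =
      (\<Sum>a\<in>J \<rightarrow>\<^sub>E B. prob {\<omega>\<in>C a. X v \<omega> = b})" if v: "v \<in> J \<union> {u}" for v b
  proof -
    have meas_v: "{\<omega>\<in>C a. X v \<omega> = b} \<in> sets M" for a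
    proof -
      have "{\<omega>\<in>space M. X v \<omega> = b} \<in> sets M"
        using sets_Collect_count_space[OF meas[OF v], of "{b}"] by simp
      moreover have "{\<omega>\<in>C a. X v \<omega> = b} = C a \<inter> {\<omega>\<in>space M. X v \<omega> = b}"
        by (auto simp: C_def)
      ultimately show ?thesis by auto
    qed
    have eq: "{\<omega>\<in>space M. (\<forall>s\<in>J. X s \<omega> \<in> B) \<and> X v \<omega> = b} =
        (\<Union>a\<in>J \<rightarrow>\<^sub>E B. {\<omega>\<in>C a. X v \<omega> = b})"
    proof (intro subset_antisym subsetI)
      fix \<omega> assume "\<omega> \<in> {\<omega>\<in>space M. (\<forall>s\<in>J. X s \<omega> \<in> B) \<and> X v \<omega> = b}"
      then show "\<omega> \<in> (\<Union>a\<in>J \<rightarrow>\<^sub>E B. {\<omega>\<in>C a. X v \<omega> = b})"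
        by (intro UN_I[of "restrict (\<lambda>s. X s \<omega>) J"]) (auto simp: C_def)
    qed (auto simp: C_def PiE_iff)
    have "disjoint_family_on (\<lambda>a. {\<omega>\<in>C a. X v \<omega> = b}) (J \<rightarrow>\<^sub>E B)"
      unfolding disjoint_family_on_def
    proof (intro ballI impI)
      fix a a' assume a: "a \<in> J \<rightarrow>\<^sub>E B" "a' \<in> J \<rightarrow>\<^sub>E B" "a \<noteq> a'"
      then obtain s where "s \<in> J" "a s \<noteq> a' s"
        using PiE_ext by blast
      then show "{\<omega>\<in>C a. X v \<omega> = b} \<inter> {\<omega>\<in>C a'. X v \<omega> = b} = {}"
        by (auto simp: C_def)
    qed
    then show ?thesis
      unfolding eq using meas_v fin finB
      by (intro finite_measure_finite_Union) (auto intro: finite_PiE)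
  qed
  have cond: "prob {\<omega>\<in>C a. X u \<omega> = y} = prob (C a) * r (a t)" for a
  proof (cases "prob (C a) > 0")
    case True
    have "{\<omega>\<in>C a. X u \<omega> = y} = {\<omega>\<in>space M. X u \<omega> = y \<and> (\<forall>s\<in>J. X s \<omega> = a s)}"
      by (auto simp: C_def)
    with mk[of a] True show ?thesis
      by (auto simp: cond_prob_def C_def[symmetric] field_simps)
  next
    case False
    then have "prob (C a) = 0" using measure_nonneg[of M "C a"] by linarith
    moreover have "prob {\<omega>\<in>C a. X u \<omega> = y} \<le> prob (C a)"
      by (rule finite_measure_mono) auto
    ultimately show ?thesis using measure_nonneg[of M "{\<omega>\<in>C a. X u \<omega> = y}"] by simp
  qed
  have pres: "prob {\<omega>\<in>C a. X t \<omega> = x} = (if a t = x then prob (C a) else 0)" for a x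
  proof -
    have "{\<omega>\<in>C a. X t \<omega> = x} = (if a t = x then C a else {})"
      using t by (auto simp: C_def)
    then show ?thesis by simp
  qed
  have "(\<Sum>x\<in>B. prob {\<omega>\<in>space M. (\<forall>s\<in>J. X s \<omega> \<in> B) \<and> X t \<omega> = x} * r x) =
      (\<Sum>x\<in>B. \<Sum>a\<in>J \<rightarrow>\<^sub>E B. (if a t = x then prob (C a) * r x else 0))"
    using t by (auto simp: split pres sum_distrib_right intro!: sum.cong)
  also have "\<dots> = (\<Sum>a\<in>J \<rightarrow>\<^sub>E B. prob (C a) * r (a t))"
    using t finB by (subst sum.swap) (auto intro!: sum.cong simp: PiE_iff sum.delta)
  also have "\<dots> = prob {\<omega>\<in>space M. (\<forall>s\<in>J. X s \<omega> \<in> B) \<and> X u \<omega> = y}"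
    by (subst split) (auto simp: cond)
  finally show ?thesis by simp
qed

lemma grid_hitting_time_eq_suminf:
  assumes "0 < \<delta>"
  shows "(INF k\<in>{k. x (real k * \<delta>) = y}. ennreal (real k * \<delta>)) =
    (\<Sum>k. ennreal \<delta> * indicator {x. \<forall>j\<le>k. x (real j * \<delta>) \<noteq> y} x)"
proof (cases "\<exists>k. x (real k * \<delta>) = y")
  case False
  have "\<not> summable (\<lambda>_::nat. \<delta>)"
    using assms summable_LIMSEQ_zero[of "\<lambda>_. \<delta>"] by (auto simp: LIMSEQ_const_iff)
  then have "(\<Sum>k::nat. ennreal \<delta>) = top"
    using assms by (intro summable_iff_suminf_neq_top) auto
  with False show ?thesis by (simp add: indicator_def)
next
  case True
  define N where "N = (LEAST k. x (real k * \<delta>) = y)"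
  have N: "x (real N * \<delta>) = y" unfolding N_def using True by (rule LeastI_ex)
  have less: "x (real k * \<delta>) \<noteq> y" if "k < N" for k
    using that unfolding N_def by (rule not_less_Least)
  have "(\<Sum>k. ennreal \<delta> * indicator {x. \<forall>j\<le>k. x (real j * \<delta>) \<noteq> y} x) =
      (\<Sum>k<N. ennreal \<delta> * indicator {x. \<forall>j\<le>k. x (real j * \<delta>) \<noteq> y} x)"
  proof (intro suminf_finite)
    fix k assume "k \<notin> {..<N}"
    then have "\<not> (\<forall>j\<le>k. x (real j * \<delta>) \<noteq> y)" using N by (auto simp: not_less)
    then show "ennreal \<delta> * indicator {x. \<forall>j\<le>k. x (real j * \<delta>) \<noteq> y} x = 0" by simp
  qed simp
  also have "\<dots> = (\<Sum>k<N. ennreal \<delta>)"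
    using less by (intro sum.cong refl) (auto simp: indicator_def)
  also have "\<dots> = ennreal (real N * \<delta>)"
    using assms by (simp add: ennreal_mult ennreal_of_nat_eq_real_of_nat)
  also have "\<dots> = (INF k\<in>{k. x (real k * \<delta>) = y}. ennreal (real k * \<delta>))"
  proof (rule antisym)
    show "ennreal (real N * \<delta>) \<le> (INF k\<in>{k. x (real k * \<delta>) = y}. ennreal (real k * \<delta>))"
    proof (rule INF_greatest)
      fix k assume "k \<in> {k. x (real k * \<delta>) = y}"
      then have "N \<le> k" unfolding N_def by (auto intro: Least_le)
      then show "ennreal (real N * \<delta>) \<le> ennreal (real k * \<delta>)"
        using assms by (intro ennreal_leI mult_right_mono) auto
    qed
  qed (use N in \<open>auto intro: INF_lower\<close>)
  finally show ?thesis by simp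
qed

text \<open>
  By right-continuity a visit to \<open>y\<close> lasts for an interval, which contains grid points of every
  sufficiently fine grid arbitrarily close to its left end. The condition \<open>x 0 \<noteq> y\<close> excludes
  the grid point \<open>0\<close>, which is not a candidate on the left-hand side.
\<close>

lemma hitting_time_eq_INF_dyadic:
  fixes x :: "real \<Rightarrow> 's"
  assumes rc: "\<forall>t\<ge>0. \<forall>\<^sub>F s in at_right t. x s = x t" and "x 0 \<noteq> y"
  shows "(INF t\<in>{t. 0 < t \<and> x t = y}. ennreal t) =
    (INF n\<in>UNIV. INF k\<in>{k. x (real k * (1/2)^(n + m)) = y}. ennreal (real k * (1/2)^(n + m)))"
proof (rule antisym)
  show "(INF t\<in>{t. 0 < t \<and> x t = y}. ennreal t) \<le>
    (INF n\<in>UNIV. INF k\<in>{k. x (real k * (1/2)^(n + m)) = y}. ennreal (real k * (1/2)^(n + m)))"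
  proof (intro INF_greatest)
    fix n k assume k: "k \<in> {k. x (real k * (1/2)^(n + m)) = y}"
    then have "k \<noteq> 0" using assms(2) by (cases "k = 0") auto
    with k show "(INF t\<in>{t. 0 < t \<and> x t = y}. ennreal t) \<le> ennreal (real k * (1/2)^(n + m))"
      by (intro INF_lower) auto
  qed
next
  show "(INF n\<in>UNIV. INF k\<in>{k. x (real k * (1/2)^(n + m)) = y}. ennreal (real k * (1/2)^(n + m)))
      \<le> (INF t\<in>{t. 0 < t \<and> x t = y}. ennreal t)" (is "?R \<le> _")
  proof (rule INF_greatest)
    fix t assume t: "t \<in> {t. 0 < t \<and> x t = y}"
    then have "\<forall>\<^sub>F s in at_right t. x s = x t" using rc by auto
    then obtain b where b: "b > t" "\<And>s. t < s \<Longrightarrow> s < b \<Longrightarrow> x s = y"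
      using t unfolding eventually_at_right_field by auto
    have *: "?R \<le> ennreal c" if c: "t < c" "c < b" for c
    proof -
      obtain n where n: "(1/2)^n < c - t"
        using real_arch_pow_inv[of "c - t" "1/2"] c by auto
      define d :: real where "d = (1/2)^(n + m)"
      have "d \<le> (1/2)^n" unfolding d_def by (intro power_decreasing) auto
      then have "d < c - t" using n by linarith
      moreover have "0 < d" by (simp add: d_def)
      ultimately have d: "0 < d" "d < c - t" by simp_all
      define k where "k = nat (\<lfloor>t / d\<rfloor> + 1)"
      have "0 \<le> \<lfloor>t / d\<rfloor>" using t d by auto
      then have "real k = of_int \<lfloor>t / d\<rfloor> + 1" by (simp add: k_def)
      then have "t / d < real k" "real k \<le> t / d + 1" by linarith+
      then have k: "t < real k * d" "real k * d \<le> t + d"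
        using d by (simp_all add: field_simps)
      then have "x (real k * d) = y" using b c d by auto
      then have "?R \<le> ennreal (real k * d)"
        unfolding d_def by (intro INF_lower2[of n] INF_lower) auto
      also have "\<dots> \<le> ennreal c" using k d by (intro ennreal_leI) auto
      finally show ?thesis .
    qed
    have "((\<lambda>c. ennreal c) \<longlongrightarrow> ennreal t) (at_right t)"
      by (intro tendsto_intros)
    moreover have "\<forall>\<^sub>F c in at_right t. ?R \<le> ennreal c"
      unfolding eventually_at_right_field using * b by blast
    ultimately show "?R \<le> ennreal t"
      by (rule tendsto_lowerbound) auto
  qed
qed

text \<open>
  Here \<open>w k x\<close> is the probability of being at \<open>x\<close> at the grid time \<open>k * \<delta>\<close> without having met
  \<open>y\<close> at a grid time so far, a chain killed at \<open>y\<close> with transition matrix \<open>p \<delta>\<close>. The factor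
  \<open>\<delta>\<close> converts the number of steps into time.
\<close>

lemma grid_hitting_time_mean_bounds:
  assumes M: "markov_process M S q x0 X"
    and h: "\<And>x. x \<in> S \<Longrightarrow> 0 \<le> h x" and x0: "x0 \<in> S" "x0 \<noteq> y" and y: "y \<in> S"
    and p: "transition_function S q p"
    and mk: "\<forall>t\<ge>0. \<forall>h\<ge>0. \<forall>J a. \<forall>y\<in>S.
           finite J \<and> J \<subseteq> {0..t} \<and> t \<in> J \<and> \<P>(\<omega> in M. \<forall>s\<in>J. X s \<omega> = a s) > 0 \<longrightarrow>
           \<P>(\<omega> in M. X (t + h) \<omega> = y \<bar> \<forall>s\<in>J. X s \<omega> = a s) = p h (a t) y"
    and \<delta>: "0 < \<delta>" and c: "0 < c"
    and lo: "\<And>x. x \<in> S - {y} \<Longrightarrow> c \<le> h x - (\<Sum>z\<in>S - {y}. p \<delta> x z * h z)"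
    and up: "\<And>x. x \<in> S - {y} \<Longrightarrow> h x - (\<Sum>z\<in>S - {y}. p \<delta> x z * h z) \<le> C"
  defines "\<tau> \<equiv> \<lambda>\<omega>. INF k\<in>{k. X (real k * \<delta>) \<omega> = y}. ennreal (real k * \<delta>)"
  shows "\<tau> \<in> borel_measurable M"
    and "ennreal (\<delta> * h x0 / C) \<le> (\<integral>\<^sup>+\<omega>. \<tau> \<omega> \<partial>M)"
    and "(\<integral>\<^sup>+\<omega>. \<tau> \<omega> \<partial>M) \<le> ennreal (\<delta> * h x0 / c)"
proof -
  interpret prob_space M using M by (simp add: markov_process_def)
  have fin: "finite S" using p by (simp add: transition_function_def)
  have X: "X t \<in> measurable M (count_space S)" if "0 \<le> t" for t
    using M that by (simp add: markov_process_def)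
  have XS: "X t \<omega> \<in> S" if "0 \<le> t" "\<omega> \<in> space M" for t \<omega>
    using measurable_space[OF X] that by simp
  have X_sets: "{\<omega>\<in>space M. X t \<omega> \<in> B} \<in> sets M" if "0 \<le> t" for t B
    by (rule sets_Collect_count_space[OF X[OF that]])
  define B where "B = S - {y}"
  define J where "J k = (\<lambda>j. real j * \<delta>) ` {..k}" for k
  define A where "A k = {\<omega>\<in>space M. \<forall>s\<in>J k. X s \<omega> \<in> B}" for k
  define w where "w k x = prob {\<omega>\<in>space M. (\<forall>s\<in>J k. X s \<omega> \<in> B) \<and> X (real k * \<delta>) \<omega> = x}" for k x
  have J0: "0 \<le> s" if "s \<in> J k" for s k using that \<delta> by (auto simp: J_def)
  have A[measurable]: "A k \<in> sets M" for k
    unfolding A_def by (intro sets.sets_Collect_finite_All X_sets) (auto simp: J0, simp add: J_def)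
  have w_sets: "{\<omega>\<in>space M. (\<forall>s\<in>J k. X s \<omega> \<in> B) \<and> X (real k * \<delta>) \<omega> = x} \<in> sets M" for k x
  proof -
    have "A k \<inter> {\<omega>\<in>space M. X (real k * \<delta>) \<omega> \<in> {x}} \<in> sets M"
      using \<delta> by (intro sets.Int A X_sets) auto
    also have "A k \<inter> {\<omega>\<in>space M. X (real k * \<delta>) \<omega> \<in> {x}} =
        {\<omega>\<in>space M. (\<forall>s\<in>J k. X s \<omega> \<in> B) \<and> X (real k * \<delta>) \<omega> = x}"
      by (auto simp: A_def)
    finally show ?thesis .
  qed
  have A_eq: "A k = {\<omega>\<in>space M. \<forall>j\<le>k. X (real j * \<delta>) \<omega> \<noteq> y}" for k
    using XS \<delta> by (auto simp: A_def J_def B_def)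
  have prob_A: "prob (A k) = (\<Sum>x\<in>B. w k x)" for k
  proof -
    have "A k = (\<Union>x\<in>B. {\<omega>\<in>space M. (\<forall>s\<in>J k. X s \<omega> \<in> B) \<and> X (real k * \<delta>) \<omega> = x})"
      by (auto simp: A_def J_def)
    also have "prob \<dots> = (\<Sum>x\<in>B. w k x)"
      unfolding w_def using w_sets fin
      by (intro finite_measure_finite_Union) (auto simp: disjoint_family_on_def B_def)
    finally show ?thesis .
  qed
  have step: "w (Suc k) z = (\<Sum>x\<in>B. w k x * p \<delta> x z)" if z: "z \<in> B" for k z
  proof -
    define t where "t = real k * \<delta>"
    have t: "0 \<le> t" "t \<in> J k" "J k \<subseteq> {0..t}" "finite (J k)"
      using \<delta> by (auto simp: t_def J_def)
    have u: "real (Suc k) * \<delta> = t + \<delta>" by (simp add: t_def algebra_simps)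
    have J_Suc: "J (Suc k) = insert (t + \<delta>) (J k)"
      unfolding J_def by (simp add: atMost_Suc algebra_simps t_def)
    have "w (Suc k) z = \<P>(\<omega> in M. (\<forall>s\<in>J k. X s \<omega> \<in> B) \<and> X (t + \<delta>) \<omega> = z)"
      unfolding w_def u J_Suc using z by (intro arg_cong[where f = prob]) auto
    also have "\<dots> = (\<Sum>x\<in>B. \<P>(\<omega> in M. (\<forall>s\<in>J k. X s \<omega> \<in> B) \<and> X t \<omega> = x) * p \<delta> x z)"
    proof (rule markov_event[where S = S])
      fix a assume "0 < \<P>(\<omega> in M. \<forall>s\<in>J k. X s \<omega> = a s)"
      then show "\<P>(\<omega> in M. X (t + \<delta>) \<omega> = z \<bar> \<forall>s\<in>J k. X s \<omega> = a s) = p \<delta> (a t) z"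
        using mk t \<delta> z by (auto simp: B_def)
    qed (use t fin X J0 \<delta> in \<open>auto simp: B_def\<close>)
    finally show ?thesis by (simp add: w_def t_def)
  qed
  have w_0: "w 0 x = (if x = x0 then 1 else 0)" if "x \<in> B" for x
  proof -
    have AE0: "AE \<omega> in M. X 0 \<omega> = x0" using M by (simp add: markov_process_def)
    have "w 0 x = prob {\<omega>\<in>space M. X 0 \<omega> \<in> {x}}"
      unfolding w_def J_def using that by (intro arg_cong[where f = prob]) auto
    also have "\<dots> = (if x = x0 then 1 else 0)"
    proof (cases "x = x0")
      case True
      have "prob {\<omega>\<in>space M. X 0 \<omega> \<in> {x}} = 1"
        using AE0 True X_sets[of 0 "{x}"] by (subst prob_Collect_eq_1) auto
      with True show ?thesis by simp
    next
      case False
      have "prob {\<omega>\<in>space M. X 0 \<omega> \<in> {x}} = 0"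
        using AE0 False X_sets[of 0 "{x}"] by (subst prob_Collect_eq_0) auto
      with False show ?thesis by simp
    qed
    finally show ?thesis .
  qed
  have finB: "finite B" using fin by (simp add: B_def)
  have start: "(\<Sum>x\<in>B. w 0 x * h x) = h x0"
    using finB x0 by (simp add: w_0 B_def if_distrib[of "\<lambda>u. u * _"] cong: if_cong)
  note bounds = killed_chain_bounds[of B w "p \<delta>" h c C, OF finB _ step _ c]
  have w_nn: "0 \<le> w k x" for k x unfolding w_def by simp
  have summ: "summable (\<lambda>k. prob (A k))"
    unfolding prob_A by (rule bounds) (use w_nn h lo up in \<open>auto simp: B_def\<close>)
  have lower: "c * (\<Sum>k. prob (A k)) \<le> h x0"
    unfolding prob_A start[symmetric] by (rule bounds) (use w_nn h lo up in \<open>auto simp: B_def\<close>)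
  have upper: "h x0 \<le> C * (\<Sum>k. prob (A k))"
    unfolding prob_A start[symmetric] by (rule bounds) (use w_nn h lo up in \<open>auto simp: B_def\<close>)
  have cC: "0 < C" using lo[of x0] up[of x0] x0 c by auto
  have \<tau>: "\<tau> \<omega> = (\<Sum>k. ennreal \<delta> * indicator (A k) \<omega>)" if "\<omega> \<in> space M" for \<omega>
    using that unfolding \<tau>_def grid_hitting_time_eq_suminf[OF \<delta>, of "\<lambda>t. X t \<omega>"]
    by (auto simp: A_eq indicator_def intro!: suminf_cong)
  show "\<tau> \<in> borel_measurable M"
    by (subst measurable_cong[OF \<tau>]) auto
  have "(\<integral>\<^sup>+\<omega>. \<tau> \<omega> \<partial>M) = (\<integral>\<^sup>+\<omega>. (\<Sum>k. ennreal \<delta> * indicator (A k) \<omega>) \<partial>M)"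
    by (rule nn_integral_cong[OF \<tau>])
  also have "\<dots> = (\<Sum>k. ennreal (\<delta> * prob (A k)))"
    using \<delta> by (subst nn_integral_suminf)
      (auto simp: nn_integral_cmult emeasure_eq_measure ennreal_mult simp del: ennreal_suminf_cmult)
  also have "\<dots> = ennreal (\<delta> * (\<Sum>k. prob (A k)))"
    using summ \<delta> by (subst suminf_ennreal2) (auto simp: suminf_mult summable_mult)
  finally have E: "(\<integral>\<^sup>+\<omega>. \<tau> \<omega> \<partial>M) = ennreal (\<delta> * (\<Sum>k. prob (A k)))" .
  show "(\<integral>\<^sup>+\<omega>. \<tau> \<omega> \<partial>M) \<le> ennreal (\<delta> * h x0 / c)"
    unfolding E using lower c \<delta> by (intro ennreal_leI) (simp add: field_simps)
  show "ennreal (\<delta> * h x0 / C) \<le> (\<integral>\<^sup>+\<omega>. \<tau> \<omega> \<partial>M)"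
    unfolding E using upper cC \<delta> by (intro ennreal_leI) (simp add: field_simps)
qed

section \<open>Mean hitting times from the generator\<close>

text \<open>
  Deleting \<open>y\<close> from the sum costs nothing because \<open>h y = 0\<close>; this turns the generator of the
  process into the one-step loss of the chain killed at \<open>y\<close>. The diagonal rate enters only through
  the row sums of \<open>p\<close>.
\<close>

lemma transition_function_generator:
  assumes p: "transition_function S q p" and x: "x \<in> S" and "y \<in> S" and h: "h y = 0"
  shows "((\<lambda>t. (h x - (\<Sum>z\<in>S - {y}. p t x z * h z)) / t) \<longlongrightarrow>
    - (\<Sum>z\<in>S - {x}. q x z * (h z - h x))) (at_right 0)"
proof -
  have fin: "finite S" using p by (simp add: transition_function_def)
  have "((\<lambda>t. - (\<Sum>z\<in>S - {x}. p t x z / t * (h z - h x))) \<longlongrightarrow>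
    - (\<Sum>z\<in>S - {x}. q x z * (h z - h x))) (at_right 0)"
    using p x by (intro tendsto_intros) (auto simp: transition_function_def)
  moreover have "\<forall>\<^sub>F t in at_right 0. - (\<Sum>z\<in>S - {x}. p t x z / t * (h z - h x)) =
      (h x - (\<Sum>z\<in>S - {y}. p t x z * h z)) / t"
    unfolding eventually_at_right_field
  proof (intro exI[of _ 1] conjI allI impI)
    fix t :: real assume t: "0 < t"
    then have "(\<Sum>z\<in>S. p t x z) = 1" using p x by (simp add: transition_function_def)
    moreover have "(\<Sum>z\<in>S. p t x z * (h z - h x)) =
        (\<Sum>z\<in>S. p t x z * h z) - (\<Sum>z\<in>S. p t x z) * h x"
      by (simp add: right_diff_distrib sum_subtractf sum_distrib_right)
    ultimately have "h x - (\<Sum>z\<in>S. p t x z * h z) = - (\<Sum>z\<in>S. p t x z * (h z - h x))"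
      by simp
    also have "(\<Sum>z\<in>S. p t x z * (h z - h x)) = (\<Sum>z\<in>S - {x}. p t x z * (h z - h x))"
      by (simp add: sum.remove[OF fin x])
    also have "(\<Sum>z\<in>S. p t x z * h z) = (\<Sum>z\<in>S - {y}. p t x z * h z)"
      using h by (simp add: sum.remove[OF fin \<open>y \<in> S\<close>])
    finally show "- (\<Sum>z\<in>S - {x}. p t x z / t * (h z - h x)) =
      (h x - (\<Sum>z\<in>S - {y}. p t x z * h z)) / t"
      by (simp add: sum_divide_distrib)
  qed simp
  ultimately show ?thesis by (rule Lim_transform_eventually)
qed

text \<open>
  The one-step loss on the grid of mesh \<open>\<delta> n\<close> is \<open>\<delta> n * g n x\<close> with \<open>g n x\<close> tending to \<open>1\<close>;
  \<open>err n\<close> bounds the deviation uniformly over the finite state space. This squeezes the mean grid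
  hitting times to \<open>h x0\<close>. They are finite once \<open>err n < 1\<close>, so the passage to the limit starts at
  an index \<open>m\<close> beyond which this holds.
\<close>

theorem mean_first_passage_time_eqI:
  assumes M: "markov_process M S q x0 X" and x0: "x0 \<in> S" "x0 \<noteq> y" and y: "y \<in> S"
    and h: "\<And>x. x \<in> S \<Longrightarrow> 0 \<le> h x" "h y = 0"
    and gen: "\<And>x. x \<in> S - {y} \<Longrightarrow> (\<Sum>z\<in>S - {x}. q x z * (h z - h x)) = -1"
  shows "mean_first_passage_time M X y = ennreal (h x0)"
proof -
  from M obtain p where p: "transition_function S q p"
    and mk: "\<forall>t\<ge>0. \<forall>h\<ge>0. \<forall>J a. \<forall>y\<in>S.
           finite J \<and> J \<subseteq> {0..t} \<and> t \<in> J \<and> \<P>(\<omega> in M. \<forall>s\<in>J. X s \<omega> = a s) > 0 \<longrightarrow>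
           \<P>(\<omega> in M. X (t + h) \<omega> = y \<bar> \<forall>s\<in>J. X s \<omega> = a s) = p h (a t) y"
    unfolding markov_process_def by blast
  have fin: "finite S" using p by (simp add: transition_function_def)
  define \<delta> :: "nat \<Rightarrow> real" where "\<delta> n = (1/2)^n" for n
  have \<delta>_pos: "0 < \<delta> n" for n by (simp add: \<delta>_def)
  have "\<delta> \<longlonglongrightarrow> 0" unfolding \<delta>_def by (intro LIMSEQ_power_zero) simp
  then have \<delta>_lim: "filterlim \<delta> (at_right 0) sequentially"
    using \<delta>_pos by (auto simp: filterlim_at less_imp_neq[symmetric] intro!: always_eventually)
  define g where "g n x = (h x - (\<Sum>z\<in>S - {y}. p (\<delta> n) x z * h z)) / \<delta> n" for n x
  have g: "(\<lambda>n. g n x) \<longlonglongrightarrow> 1" if "x \<in> S - {y}" for x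
    unfolding g_def
    using filterlim_compose[OF transition_function_generator[of S q p x y h] \<delta>_lim] p y h(2) gen[OF that] that
    by simp
  define err where "err n = (\<Sum>x\<in>S - {y}. \<bar>g n x - 1\<bar>)" for n
  have err0: "0 \<le> err n" for n unfolding err_def by (intro sum_nonneg) simp
  have "err \<longlonglongrightarrow> (\<Sum>x\<in>S - {y}. \<bar>1 - 1\<bar>)"
    unfolding err_def by (intro tendsto_intros g)
  then have err: "err \<longlonglongrightarrow> 0" by simp
  have g_err: "\<bar>g n x - 1\<bar> \<le> err n" if "x \<in> S - {y}" for n x
    unfolding err_def using that fin
    by (intro member_le_sum[where f = "\<lambda>x. \<bar>g n x - 1\<bar>"]) auto
  define \<tau> where "\<tau> n \<omega> = (INF k\<in>{k. X (real k * \<delta> n) \<omega> = y}. ennreal (real k * \<delta> n))" for n \<omega>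
  have \<tau>: "\<tau> n \<in> borel_measurable M"
      "ennreal (h x0 / (1 + err n)) \<le> (\<integral>\<^sup>+\<omega>. \<tau> n \<omega> \<partial>M)"
      "(\<integral>\<^sup>+\<omega>. \<tau> n \<omega> \<partial>M) \<le> ennreal (h x0 / (1 - err n))" if e: "err n < 1" for n
  proof -
    have lo: "\<delta> n * (1 - err n) \<le> h x - (\<Sum>z\<in>S - {y}. p (\<delta> n) x z * h z)"
      and up: "h x - (\<Sum>z\<in>S - {y}. p (\<delta> n) x z * h z) \<le> \<delta> n * (1 + err n)" if "x \<in> S - {y}" for x
    proof -
      have "h x - (\<Sum>z\<in>S - {y}. p (\<delta> n) x z * h z) = \<delta> n * g n x"
        using \<delta>_pos[of n] by (simp add: g_def)
      moreover have "1 - err n \<le> g n x" "g n x \<le> 1 + err n"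
        using g_err[OF that, of n] by linarith+
      ultimately show "\<delta> n * (1 - err n) \<le> h x - (\<Sum>z\<in>S - {y}. p (\<delta> n) x z * h z)"
        "h x - (\<Sum>z\<in>S - {y}. p (\<delta> n) x z * h z) \<le> \<delta> n * (1 + err n)"
        using \<delta>_pos[of n] by (simp_all add: mult_left_mono)
    qed
    have pos: "0 < \<delta> n * (1 - err n)" using e \<delta>_pos[of n] by simp
    note * = grid_hitting_time_mean_bounds[of M S q x0 X h y p "\<delta> n" "\<delta> n * (1 - err n)" "\<delta> n * (1 + err n)",
        OF M h(1) x0 y p mk \<delta>_pos pos lo up]
    show "\<tau> n \<in> borel_measurable M" unfolding \<tau>_def[abs_def] by (rule *) auto
    have "\<delta> n \<noteq> 0" using \<delta>_pos[of n] by simp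
    then have eq: "\<delta> n * h x0 / (\<delta> n * u) = h x0 / u" for u by simp
    show "ennreal (h x0 / (1 + err n)) \<le> (\<integral>\<^sup>+\<omega>. \<tau> n \<omega> \<partial>M)"
      using *(2) unfolding eq \<tau>_def by blast
    show "(\<integral>\<^sup>+\<omega>. \<tau> n \<omega> \<partial>M) \<le> ennreal (h x0 / (1 - err n))"
      using *(3) unfolding eq \<tau>_def by blast
  qed
  have ev: "\<forall>\<^sub>F n in sequentially. err n < 1"
    using order_tendstoD(2)[OF err, of 1] by simp
  then obtain m where m: "\<And>n. m \<le> n \<Longrightarrow> err n < 1"
    unfolding eventually_sequentially by blast
  have dec: "\<tau> (Suc n) \<omega> \<le> \<tau> n \<omega>" for n \<omega>
    unfolding \<tau>_def
  proof (rule INF_greatest)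
    fix k assume k: "k \<in> {k. X (real k * \<delta> n) \<omega> = y}"
    have "real (2 * k) * \<delta> (Suc n) = real k * \<delta> n" by (simp add: \<delta>_def)
    with k show "(INF k\<in>{k. X (real k * \<delta> (Suc n)) \<omega> = y}. ennreal (real k * \<delta> (Suc n)))
        \<le> ennreal (real k * \<delta> n)"
      by (intro INF_lower2[of "2 * k"]) (auto simp only: mem_Collect_eq)
  qed
  have "(\<lambda>n. \<integral>\<^sup>+\<omega>. \<tau> n \<omega> \<partial>M) \<longlonglongrightarrow> ennreal (h x0)"
  proof (rule tendsto_sandwich)
    show "\<forall>\<^sub>F n in sequentially. ennreal (h x0 / (1 + err n)) \<le> (\<integral>\<^sup>+\<omega>. \<tau> n \<omega> \<partial>M)"
      using ev by eventually_elim (rule \<tau>)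
    show "\<forall>\<^sub>F n in sequentially. (\<integral>\<^sup>+\<omega>. \<tau> n \<omega> \<partial>M) \<le> ennreal (h x0 / (1 - err n))"
      using ev by eventually_elim (rule \<tau>)
    have "(\<lambda>n. h x0 / (1 + err n)) \<longlonglongrightarrow> h x0 / (1 + 0)"
      by (intro tendsto_intros err) simp
    then show "(\<lambda>n. ennreal (h x0 / (1 + err n))) \<longlonglongrightarrow> ennreal (h x0)"
      by (intro tendsto_ennrealI) simp
    have "(\<lambda>n. h x0 / (1 - err n)) \<longlonglongrightarrow> h x0 / (1 - 0)"
      by (intro tendsto_intros err) simp
    then show "(\<lambda>n. ennreal (h x0 / (1 - err n))) \<longlonglongrightarrow> ennreal (h x0)"
      by (intro tendsto_ennrealI) simp
  qed
  then have lim: "(\<lambda>n. \<integral>\<^sup>+\<omega>. \<tau> (n + m) \<omega> \<partial>M) \<longlonglongrightarrow> ennreal (h x0)"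
    by (rule LIMSEQ_ignore_initial_segment)
  moreover have "decseq (\<lambda>n. \<integral>\<^sup>+\<omega>. \<tau> (n + m) \<omega> \<partial>M)"
    by (intro decseq_SucI nn_integral_mono) (simp add: dec)
  then have "(\<lambda>n. \<integral>\<^sup>+\<omega>. \<tau> (n + m) \<omega> \<partial>M) \<longlonglongrightarrow> (INF n. \<integral>\<^sup>+\<omega>. \<tau> (n + m) \<omega> \<partial>M)"
    by (rule LIMSEQ_INF)
  ultimately have INF_eq: "(INF n. \<integral>\<^sup>+\<omega>. \<tau> (n + m) \<omega> \<partial>M) = ennreal (h x0)"
    by (metis LIMSEQ_unique)
  have "AE \<omega> in M. X 0 \<omega> = x0" "AE \<omega> in M. \<forall>t\<ge>0. \<forall>\<^sub>F s in at_right t. X s \<omega> = X t \<omega>"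
    using M by (auto simp: markov_process_def)
  then have "AE \<omega> in M. first_passage_time X y \<omega> = (INF n. \<tau> (n + m) \<omega>)"
  proof eventually_elim
    case (elim \<omega>)
    then show ?case
      using hitting_time_eq_INF_dyadic[of "\<lambda>t. X t \<omega>" y m] x0
      by (simp add: first_passage_time_def \<tau>_def \<delta>_def)
  qed
  then have "mean_first_passage_time M X y = (\<integral>\<^sup>+\<omega>. (INF n. \<tau> (n + m) \<omega>) \<partial>M)"
    unfolding mean_first_passage_time_def by (rule nn_integral_cong_AE)
  also have "\<dots> = (INF n. \<integral>\<^sup>+\<omega>. \<tau> (n + m) \<omega> \<partial>M)"
  proof (rule nn_integral_monotone_convergence_INF_AE')
    show "(\<integral>\<^sup>+\<omega>. \<tau> (0 + m) \<omega> \<partial>M) < \<infinity>"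
      using \<tau>(3)[OF m[of m]] by (auto simp: less_top[symmetric] top_unique)
  qed (auto simp: dec intro!: \<tau>(1) m)
  finally show ?thesis using INF_eq by simp
qed

section \<open>Passage times along a branch\<close>

text \<open>
  The mean time to pass from \<open>l\<close> to \<open>l - 1\<close> in a birth-death chain on \<open>0..n\<close> with birth rates
  \<open>(n - l) \<nu>\<close> and death rates \<open>l\<close>: the stationary weight \<open>(n choose j) \<nu>^j\<close> of the states
  above \<open>l - 1\<close>, divided by the stationary flow \<open>l (n choose l) \<nu>^l\<close> from \<open>l\<close> to \<open>l - 1\<close>.
\<close>

definition descent :: "nat \<Rightarrow> real \<Rightarrow> nat \<Rightarrow> real" where
  "descent n \<nu> l =
     (\<Sum>j=l..n. real (n choose j) * \<nu> ^ (j - l)) / (real l * real (n choose l))"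

lemma descent_nonneg: "0 \<le> \<nu> \<Longrightarrow> 0 \<le> descent n \<nu> l"
  unfolding descent_def by (intro divide_nonneg_nonneg sum_nonneg) auto

text \<open>
  First-step analysis at \<open>l\<close>. At \<open>l = n\<close> the last factor is an empty sum, in agreement with the
  vanishing birth rate.
\<close>

lemma descent_step:
  assumes l: "0 < l" "l \<le> n"
  shows "real l * descent n \<nu> l = 1 + (real n - real l) * \<nu> * descent n \<nu> (Suc l)"
proof -
  define T where "T l = (\<Sum>j=l..n. real (n choose j) * \<nu> ^ (j - l))" for l
  have c: "real (n choose l) \<noteq> 0" using l by simp
  have T: "T l = real (n choose l) + \<nu> * T (Suc l)"
  proof -
    have "T l = real (n choose l) + (\<Sum>j=Suc l..n. real (n choose j) * \<nu> ^ (j - l))"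
      unfolding T_def using l by (subst sum.atLeast_Suc_atMost) auto
    also have "(\<Sum>j=Suc l..n. real (n choose j) * \<nu> ^ (j - l)) = \<nu> * T (Suc l)"
      unfolding T_def sum_distrib_left
    proof (intro sum.cong refl)
      fix j assume "j \<in> {Suc l..n}"
      then have "j - l = Suc (j - Suc l)" by auto
      then show "real (n choose j) * \<nu> ^ (j - l) = \<nu> * (real (n choose j) * \<nu> ^ (j - Suc l))"
        by simp
    qed
    finally show ?thesis .
  qed
  have binom: "real (Suc l) * real (n choose Suc l) = (real n - real l) * real (n choose l)"
  proof -
    have "Suc l * (n choose Suc l) = (n - l) * (n choose l)"
      using binomial_absorption[of l n] binomial_absorb_comp[of n l] by simp
    then have "real (Suc l) * real (n choose Suc l) = real (n - l) * real (n choose l)"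
      by (metis of_nat_mult)
    then show ?thesis using l by (simp add: of_nat_diff)
  qed
  have "real l * descent n \<nu> l = T l / real (n choose l)"
    using l c by (simp add: descent_def T_def)
  also have "\<dots> = 1 + \<nu> * T (Suc l) / real (n choose l)"
    using c by (simp add: T add_divide_distrib)
  also have "\<nu> * T (Suc l) / real (n choose l) = (real n - real l) * \<nu> * descent n \<nu> (Suc l)"
  proof (cases "l = n")
    case True
    then show ?thesis by (simp add: T_def)
  next
    case False
    then have "real n - real l \<noteq> 0" by simp
    then show ?thesis
      unfolding descent_def T_def[symmetric] binom using c by (simp add: field_simps)
  qed
  finally show ?thesis .
qed

lemma tendsto_power_quotient_at_top:
  assumes "a \<le> m"
  shows "((\<lambda>\<nu>::real. \<nu> ^ a / \<nu> ^ m) \<longlongrightarrow> (if a = m then 1 else 0)) at_top"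
proof -
  have "((\<lambda>\<nu>::real. inverse \<nu> ^ (m - a)) \<longlongrightarrow> 0 ^ (m - a)) at_top"
    by (intro tendsto_intros tendsto_inverse_0_at_top filterlim_ident)
  moreover have "\<forall>\<^sub>F \<nu>::real in at_top. inverse \<nu> ^ (m - a) = \<nu> ^ a / \<nu> ^ m"
    using eventually_gt_at_top[of 0]
    by eventually_elim (use assms in \<open>simp add: power_diff power_inverse field_simps\<close>)
  ultimately have "((\<lambda>\<nu>::real. \<nu> ^ a / \<nu> ^ m) \<longlongrightarrow> 0 ^ (m - a)) at_top"
    by (rule Lim_transform_eventually)
  also have "(0::real) ^ (m - a) = (if a = m then 1 else 0)"
    using assms by (auto simp: power_0_left)
  finally show ?thesis .
qed

text \<open>
  Only the top state \<open>j = n\<close> reaches the order \<open>\<nu>^(n - l)\<close>: for large \<open>\<nu>\<close> the time is spent with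
  the whole component active.
\<close>

lemma descent_asymptotics:
  assumes "l \<le> n" "n - l \<le> m"
  shows "((\<lambda>\<nu>. descent n \<nu> l / \<nu> ^ m) \<longlongrightarrow>
    (if m = n - l then 1 / (real l * real (n choose l)) else 0)) at_top"
proof -
  have "((\<lambda>\<nu>. (\<Sum>j=l..n. real (n choose j) * (\<nu> ^ (j - l) / \<nu> ^ m)) / (real l * real (n choose l)))
      \<longlongrightarrow> (\<Sum>j=l..n. real (n choose j) * (if j - l = m then 1 else 0)) / (real l * real (n choose l)))
      at_top"
    unfolding divide_inverse[of _ "real l * real (n choose l)"] using assms
    by (intro tendsto_mult tendsto_const tendsto_sum tendsto_power_quotient_at_top) auto
  also have "(\<Sum>j=l..n. real (n choose j) * (if j - l = m then 1 else 0)) =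
      (\<Sum>j\<in>{n}. if m = n - l then 1 else 0)"
    using assms by (intro sum.mono_neutral_cong_right) auto
  finally show ?thesis
    by (simp add: descent_def sum_divide_distrib mult.commute cong: if_cong split: if_splits)
qed

text \<open>
  The mean time to pass from \<open>l\<close> to \<open>l + 1\<close>, where \<open>0\<close> is a centre from which the branch is entered
  at rate \<open>n \<nu>\<close> and \<open>c\<close> is the expected time lost elsewhere per unit of time spent in the centre:
  the sum of the rates into the other branches, weighted by the mean durations of the visits.
  Both equations come from first-step analysis.
\<close>

primrec ascent :: "real \<Rightarrow> nat \<Rightarrow> real \<Rightarrow> nat \<Rightarrow> real" where
  "ascent c n \<nu> 0 = (1 + c) / (real n * \<nu>)"
| "ascent c n \<nu> (Suc l) = (1 + real (Suc l) * ascent c n \<nu> l) / ((real n - real (Suc l)) * \<nu>)"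

lemma ascent_nonneg:
  assumes "0 \<le> c" "0 < \<nu>" "l < n"
  shows "0 \<le> ascent c n \<nu> l"
  using assms(3) by (induction l) (use assms(1,2) in auto)

section \<open>The hitting times on the star\<close>

text \<open>The value of the parameter \<open>c\<close> of \<open>ascent\<close> when the target lies on branch \<open>k2\<close>.\<close>

definition excursion_rate :: "nat \<Rightarrow> (nat \<Rightarrow> nat) \<Rightarrow> nat \<Rightarrow> real \<Rightarrow> real" where
  "excursion_rate K L k2 \<nu> = (\<Sum>k\<in>{1..K} - {k2}. real (L k) * \<nu> * descent (L k) \<nu> 1)"

text \<open>
  The mean hitting time of \<open>Active k2 l2\<close> from position \<open>l\<close> of branch \<open>k\<close>, where position \<open>0\<close> of
  every branch is the centre. The star is a tree, so passage times between neighbours add up along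
  the path to the target. For \<open>k = k2\<close> at most one of the two sums is nonempty, according to the
  side of the target on which \<open>l\<close> lies.
\<close>

definition branch_time :: "nat \<Rightarrow> (nat \<Rightarrow> nat) \<Rightarrow> nat \<Rightarrow> nat \<Rightarrow> real \<Rightarrow> nat \<Rightarrow> nat \<Rightarrow> real" where
  "branch_time K L k2 l2 \<nu> k l =
     (if k = k2
      then (\<Sum>j\<in>{l..<l2}. ascent (excursion_rate K L k2 \<nu>) (L k2) \<nu> j) + (\<Sum>j\<in>{l2<..l}. descent (L k2) \<nu> j)
      else (\<Sum>j\<in>{0..<l2}. ascent (excursion_rate K L k2 \<nu>) (L k2) \<nu> j) + (\<Sum>j\<in>{0<..l}. descent (L k) \<nu> j))"

fun star_time :: "nat \<Rightarrow> (nat \<Rightarrow> nat) \<Rightarrow> nat \<Rightarrow> nat \<Rightarrow> real \<Rightarrow> state \<Rightarrow> real" where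
  "star_time K L k2 l2 \<nu> Zero = branch_time K L k2 l2 \<nu> k2 0"
| "star_time K L k2 l2 \<nu> (Active k l) = branch_time K L k2 l2 \<nu> k l"

lemma finite_state_space: "finite (state_space K L)"
proof -
  have "state_space K L = insert Zero (\<Union>k\<in>{1..K}. Active k ` {1..L k})"
    by (auto simp: state_space_def)
  then show ?thesis by simp
qed

lemma sum_rate_Active:
  assumes x: "Active k l \<in> state_space K L"
  shows "(\<Sum>z\<in>state_space K L - {Active k l}. rate L \<nu> (Active k l) z * f z) =
    (real (L k) - real l) * \<nu> * f (Active k (Suc l)) +
    real l * f (if l = 1 then Zero else Active k (l - 1))"
proof -
  let ?S = "state_space K L - {Active k l}"
  let ?up = "Active k (Suc l)" and ?down = "if l = 1 then Zero else Active k (l - 1)"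
  have l: "1 \<le> l" "l \<le> L k" "k \<in> {1..K}" using x by (auto simp: state_space_def)
  have "(\<Sum>z\<in>?S. rate L \<nu> (Active k l) z * f z) =
      (\<Sum>z\<in>{?up, ?down} \<inter> ?S. rate L \<nu> (Active k l) z * f z)"
  proof (rule sum.mono_neutral_right)
    show "\<forall>z\<in>?S - {?up, ?down} \<inter> ?S. rate L \<nu> (Active k l) z * f z = 0"
    proof
      fix z assume "z \<in> ?S - {?up, ?down} \<inter> ?S"
      then show "rate L \<nu> (Active k l) z * f z = 0"
        by (cases z) (auto simp: state_space_def split: if_splits)
    qed
  qed (auto simp: finite_state_space)
  also have "{?up, ?down} \<inter> ?S = (if l < L k then {?up, ?down} else {?down})"
    using l by (auto simp: state_space_def)
  also have "(\<Sum>z\<in>\<dots>. rate L \<nu> (Active k l) z * f z) =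
      (real (L k) - real l) * \<nu> * f ?up + real l * f ?down"
    using l by (cases "l = 1"; cases "l = L k") auto
  finally show ?thesis .
qed

lemma sum_rate_Zero:
  assumes "\<And>k. k \<in> {1..K} \<Longrightarrow> 1 \<le> L k"
  shows "(\<Sum>z\<in>state_space K L - {Zero}. rate L \<nu> Zero z * f z) =
    (\<Sum>k=1..K. real (L k) * \<nu> * f (Active k 1))"
proof -
  have "(\<Sum>z\<in>state_space K L - {Zero}. rate L \<nu> Zero z * f z) =
      (\<Sum>z\<in>(\<lambda>k. Active k 1) ` {1..K}. rate L \<nu> Zero z * f z)"
  proof (rule sum.mono_neutral_right)
    show "\<forall>z\<in>state_space K L - {Zero} - (\<lambda>k. Active k 1) ` {1..K}. rate L \<nu> Zero z * f z = 0"
      by (auto simp: state_space_def)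
  qed (use assms in \<open>auto simp: finite_state_space\<close>, auto simp: state_space_def)
  also have "\<dots> = (\<Sum>k=1..K. real (L k) * \<nu> * f (Active k 1))"
    by (subst sum.reindex) (auto simp: inj_on_def)
  finally show ?thesis .
qed

text \<open>
  The increments of \<open>branch_time\<close> along a branch are values of \<open>- ascent\<close> between the centre and
  the target, and of \<open>descent\<close> everywhere else. In each state other than the target both
  neighbours lie on the same kind of stretch (the centre being treated as position \<open>0\<close> of the
  target branch), so that the equation is the first-step recursion of one of the two functions.
\<close>

lemma star_time_generator:
  assumes L: "\<And>k. k \<in> {1..K} \<Longrightarrow> 1 \<le> L k" and \<nu>: "0 < \<nu>"
    and k2: "k2 \<in> {1..K}" and l2: "0 < l2" "l2 \<le> L k2"
    and x: "x \<in> state_space K L - {Active k2 l2}"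
  shows "(\<Sum>z\<in>state_space K L - {x}.
    rate L \<nu> x z * (star_time K L k2 l2 \<nu> z - star_time K L k2 l2 \<nu> x)) = -1"
proof -
  define E where "E = excursion_rate K L k2 \<nu>"
  define U where "U = ascent E (L k2) \<nu>"
  define D where "D k = descent (L k) \<nu>" for k
  define b where "b = branch_time K L k2 l2 \<nu>"
  have b: "b k l = (if k = k2 then (\<Sum>j\<in>{l..<l2}. U j) + (\<Sum>j\<in>{l2<..l}. D k2 j)
      else (\<Sum>j\<in>{0..<l2}. U j) + (\<Sum>j\<in>{0<..l}. D k j))" for k l
    unfolding b_def branch_time_def U_def D_def E_def ..
  have b0: "b k 0 = b k2 0" for k by (simp add: b)
  have down: "b k (Suc l) - b k l = D k (Suc l)" if "k \<noteq> k2 \<or> l2 \<le> l" for k l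
  proof -
    have "{m<..Suc l} = insert (Suc l) {m<..l}" if "m \<le> l" for m using that by auto
    with that show ?thesis by (auto simp: b)
  qed
  have up: "b k2 (Suc l) - b k2 l = - U l" if "l < l2" for l
    using that by (simp add: b sum.atLeast_Suc_lessThan)
  have U0: "real (L k2) * \<nu> * U 0 = 1 + E"
    using l2 \<nu> by (simp add: U_def)
  have U_Suc: "(real (L k2) - real (Suc l)) * \<nu> * U (Suc l) = 1 + real (Suc l) * U l"
    if "Suc l < l2" for l
  proof -
    have "(real (L k2) - real (Suc l)) * \<nu> \<noteq> 0" using that l2 \<nu> by auto
    then show ?thesis by (simp add: U_def del: of_nat_Suc)
  qed
  show ?thesis
  proof (cases x)
    case Zero
    have diff: "star_time K L k2 l2 \<nu> (Active k 1) - star_time K L k2 l2 \<nu> Zero = b k 1 - b k 0" for k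
      unfolding b0[of k] by (simp add: b_def)
    have "(\<Sum>z\<in>state_space K L - {x}.
        rate L \<nu> x z * (star_time K L k2 l2 \<nu> z - star_time K L k2 l2 \<nu> x)) =
        (\<Sum>k=1..K. real (L k) * \<nu> * (b k 1 - b k 0))"
      unfolding Zero using L by (subst sum_rate_Zero) (simp_all only: diff)
    also have "\<dots> = real (L k2) * \<nu> * (b k2 1 - b k2 0) +
        (\<Sum>k\<in>{1..K} - {k2}. real (L k) * \<nu> * (b k 1 - b k 0))"
      using k2 by (subst sum.remove[of _ k2]) auto
    also have "b k2 1 - b k2 0 = - U 0" using up[of 0] l2 by simp
    also have "(\<Sum>k\<in>{1..K} - {k2}. real (L k) * \<nu> * (b k 1 - b k 0)) = E"
      unfolding E_def excursion_rate_def using down[of _ 0] by (intro sum.cong) (auto simp: D_def)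
    finally show ?thesis using U0 by simp
  next
    case (Active k l)
    have l: "0 < l" "l \<le> L k" and ne: "k \<noteq> k2 \<or> l \<noteq> l2" and k: "k \<in> {1..K}"
      using x Active by (auto simp: state_space_def)
    obtain i where i: "l = Suc i" using l by (cases l) auto
    have pred: "star_time K L k2 l2 \<nu> (if l = 1 then Zero else Active k (l - 1)) = b k i"
      using i b0[of k] by (auto simp: b_def)
    have "(\<Sum>z\<in>state_space K L - {x}.
        rate L \<nu> x z * (star_time K L k2 l2 \<nu> z - star_time K L k2 l2 \<nu> x)) =
        (real (L k) - real l) * \<nu> * (b k (Suc l) - b k l) - real l * (b k l - b k i)"
      unfolding Active using x Active
      by (subst sum_rate_Active) (auto simp: pred b_def algebra_simps simp del: One_nat_def)
    also have "\<dots> = -1"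
    proof (cases "k \<noteq> k2 \<or> l2 < l")
      case True
      then have "b k (Suc l) - b k l = D k (Suc l)" "b k l - b k i = D k l"
        using down[of k l] down[of k i] i by auto
      then show ?thesis using descent_step[OF l] by (simp add: D_def)
    next
      case False
      then have kl: "k = k2" "l < l2" using ne by auto
      then have "b k (Suc l) - b k l = - U l" "b k l - b k i = - U i"
        using up[of l] up[of i] i by auto
      then show ?thesis using U_Suc[of i] kl i by simp
    qed
    finally show ?thesis .
  qed
qed

lemma branch_time_nonneg:
  assumes "0 < \<nu>" "l2 \<le> L k2"
  shows "0 \<le> branch_time K L k2 l2 \<nu> k l"
proof -
  have "0 \<le> excursion_rate K L k2 \<nu>"
    unfolding excursion_rate_def
    using assms by (intro sum_nonneg mult_nonneg_nonneg descent_nonneg) auto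
  then show ?thesis
    using assms unfolding branch_time_def
    by (auto intro!: add_nonneg_nonneg sum_nonneg ascent_nonneg descent_nonneg)
qed

lemma mean_first_passage_time_star:
  assumes L: "\<And>k. k \<in> {1..K} \<Longrightarrow> 1 \<le> L k" and \<nu>: "0 < \<nu>"
    and x: "Active k1 l1 \<in> state_space K L" and y: "Active k2 l2 \<in> state_space K L" and "k1 \<noteq> k2"
    and M: "markov_process M (state_space K L) (rate L \<nu>) (Active k1 l1) X"
  shows "mean_first_passage_time M X (Active k2 l2) = ennreal (branch_time K L k2 l2 \<nu> k1 l1)"
proof -
  have k2: "k2 \<in> {1..K}" "0 < l2" "l2 \<le> L k2" using y by (auto simp: state_space_def)
  have "mean_first_passage_time M X (Active k2 l2) = ennreal (star_time K L k2 l2 \<nu> (Active k1 l1))"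
  proof (rule mean_first_passage_time_eqI[OF M x _ y])
    show "0 \<le> star_time K L k2 l2 \<nu> z" for z
      by (cases z) (auto intro!: branch_time_nonneg \<nu> k2)
    show "star_time K L k2 l2 \<nu> (Active k2 l2) = 0"
      by (simp add: branch_time_def)
  qed (use star_time_generator[of K L \<nu> k2 l2] L \<nu> k2 \<open>k1 \<noteq> k2\<close> in auto)
  then show ?thesis by simp
qed

section \<open>Asymptotics\<close>

lemma L_star_bounds:
  assumes "k \<in> {1..K} - {k2}"
  shows "L k \<le> L_star K L k2"
  unfolding L_star_def using assms by (intro Max_ge) auto

lemma descent_one_asymptotics:
  assumes "k \<in> {1..K} - {k2}" "1 \<le> L k"
  shows "((\<lambda>\<nu>. descent (L k) \<nu> 1 / \<nu> ^ (L_star K L k2 - 1)) \<longlongrightarrow>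
    (if k \<in> K_star K L k2 then 1 / real (L_star K L k2) else 0)) at_top"
proof -
  have le: "L k \<le> L_star K L k2" by (rule L_star_bounds[OF assms(1)])
  then have lim: "((\<lambda>\<nu>. descent (L k) \<nu> 1 / \<nu> ^ (L_star K L k2 - 1)) \<longlongrightarrow>
      (if L_star K L k2 - 1 = L k - 1 then 1 / (real 1 * real (L k choose 1)) else 0)) at_top"
    using assms(2) by (intro descent_asymptotics) auto
  show ?thesis
  proof (cases "k \<in> K_star K L k2")
    case True
    then have "L_star K L k2 = L k" by (simp add: K_star_def)
    with lim True show ?thesis by simp
  next
    case False
    then have "L k \<noteq> L_star K L k2" using assms(1) by (simp add: K_star_def)
    then have "L_star K L k2 - 1 \<noteq> L k - 1" using le assms(2) by linarith
    with lim False show ?thesis by (simp only: if_False)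
  qed
qed

text \<open>
  Only the step out of the centre has the order \<open>\<nu>^(L_* - 1)\<close>. Each further step gains a factor
  \<open>1/\<nu>\<close>, because an attempt to move outwards fails with probability of that order.
\<close>

lemma ascent_asymptotics:
  assumes L: "\<And>k. k \<in> {1..K} \<Longrightarrow> 1 \<le> L k"
    and k2: "k2 \<in> {1..K}"
  shows "((\<lambda>\<nu>. ascent (excursion_rate K L k2 \<nu>) (L k2) \<nu> l / \<nu> ^ (L_star K L k2 - 1)) \<longlongrightarrow>
    (if l = 0 then real (card (K_star K L k2)) / real (L k2) else 0)) at_top"
proof (induction l)
  define m where "m = L_star K L k2 - 1"
  have K_star_sub: "K_star K L k2 \<subseteq> {1..K} - {k2}" by (auto simp: K_star_def)
  have L_star_pos: "0 < L_star K L k2" if "k \<in> K_star K L k2" for k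
    using that L[of k] by (auto simp: K_star_def)
  have inv0: "((\<lambda>\<nu>::real. inverse \<nu>) \<longlongrightarrow> 0) at_top"
    by (intro tendsto_inverse_0_at_top filterlim_ident)
  have pow: "((\<lambda>\<nu>::real. 1 / \<nu> ^ m) \<longlongrightarrow> (if 0 = m then 1 else 0)) at_top"
    using tendsto_power_quotient_at_top[of 0 m] by simp
  {
    case 0
    have "((\<lambda>\<nu>. inverse \<nu> * (1 / \<nu> ^ m) * inverse (real (L k2)) +
        (\<Sum>k\<in>{1..K} - {k2}. real (L k) * (descent (L k) \<nu> 1 / \<nu> ^ m)) * inverse (real (L k2))) \<longlongrightarrow>
        0 * (if 0 = m then 1 else 0) * inverse (real (L k2)) +
        (\<Sum>k\<in>{1..K} - {k2}. real (L k) * (if k \<in> K_star K L k2 then 1 / real (L_star K L k2) else 0))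
          * inverse (real (L k2))) at_top"
      unfolding m_def
      by (intro tendsto_intros inv0 pow[unfolded m_def] descent_one_asymptotics L) auto
    also have "(\<Sum>k\<in>{1..K} - {k2}. real (L k) * (if k \<in> K_star K L k2 then 1 / real (L_star K L k2) else 0))
        = (\<Sum>k\<in>K_star K L k2. 1)"
      using K_star_sub
    proof (intro sum.mono_neutral_cong_right)
      fix k assume k: "k \<in> K_star K L k2"
      then have "L k = L_star K L k2" by (simp add: K_star_def)
      then show "real (L k) * (if k \<in> K_star K L k2 then 1 / real (L_star K L k2) else 0) = 1"
        using k L_star_pos[OF k] by simp
    qed auto
    also have "0 * (if 0 = m then 1 else 0) * inverse (real (L k2)) +
        (\<Sum>k\<in>K_star K L k2. 1) * inverse (real (L k2)) = real (card (K_star K L k2)) / real (L k2)"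
      by (simp add: divide_inverse)
    finally have lim: "((\<lambda>\<nu>. inverse \<nu> * (1 / \<nu> ^ m) * inverse (real (L k2)) +
        (\<Sum>k\<in>{1..K} - {k2}. real (L k) * (descent (L k) \<nu> 1 / \<nu> ^ m)) * inverse (real (L k2)))
        \<longlongrightarrow> real (card (K_star K L k2)) / real (L k2)) at_top" .
    have "\<forall>\<^sub>F \<nu> in at_top. inverse \<nu> * (1 / \<nu> ^ m) * inverse (real (L k2)) +
        (\<Sum>k\<in>{1..K} - {k2}. real (L k) * (descent (L k) \<nu> 1 / \<nu> ^ m)) * inverse (real (L k2)) =
        ascent (excursion_rate K L k2 \<nu>) (L k2) \<nu> 0 / \<nu> ^ m"
      using eventually_gt_at_top[of 0]
    proof eventually_elim
      case (elim \<nu>)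
      have "(\<Sum>k\<in>{1..K} - {k2}. real (L k) * (descent (L k) \<nu> 1 / \<nu> ^ m)) =
          excursion_rate K L k2 \<nu> / (\<nu> * \<nu> ^ m)"
        unfolding excursion_rate_def sum_divide_distrib
        using elim by (intro sum.cong) auto
      with elim L[OF k2] show ?case by (simp add: field_simps)
    qed
    with lim show ?case by (simp add: m_def Lim_transform_eventually)
  next
    case (Suc l)
    have "((\<lambda>\<nu>. (1 / \<nu> ^ m + real (Suc l) * (ascent (excursion_rate K L k2 \<nu>) (L k2) \<nu> l / \<nu> ^ m))
        * inverse (real (L k2) - real (Suc l)) * inverse \<nu>) \<longlongrightarrow>
        ((if 0 = m then 1 else 0) + real (Suc l) *
          (if l = 0 then real (card (K_star K L k2)) / real (L k2) else 0))
        * inverse (real (L k2) - real (Suc l)) * 0) at_top"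
      by (intro tendsto_intros inv0 pow Suc.IH[folded m_def])
    moreover have "(1 / P + s * (A / P)) * inverse d * inverse \<nu> = (1 + s * A) / (d * \<nu>) / P"
      for P s A d \<nu> :: real
      by (simp add: divide_inverse algebra_simps)
    ultimately show ?case
      by (simp add: m_def)
  }
qed

lemma branch_time_asymptotics:
  assumes L: "\<And>k. k \<in> {1..K} \<Longrightarrow> 1 \<le> L k"
    and k: "k1 \<in> {1..K}" "k2 \<in> {1..K}" "k1 \<noteq> k2"
    and l: "0 < l1" "l1 \<le> L k1" "0 < l2"
  shows "((\<lambda>\<nu>. branch_time K L k2 l2 \<nu> k1 l1 / \<nu> ^ (L_star K L k2 - 1)) \<longlongrightarrow>
    (if k1 \<in> K_star K L k2 then 1 else 0) / real (L_star K L k2)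
      + real (card (K_star K L k2)) / real (L k2)) at_top"
proof -
  define m where "m = L_star K L k2 - 1"
  have le: "L k1 \<le> L_star K L k2" using k by (intro L_star_bounds) auto
  have D: "((\<lambda>\<nu>. descent (L k1) \<nu> j / \<nu> ^ m) \<longlongrightarrow>
      (if j = 1 then (if k1 \<in> K_star K L k2 then 1 / real (L_star K L k2) else 0) else 0)) at_top"
    if j: "j \<in> {0<..l1}" for j
  proof (cases "j = 1")
    case True
    then show ?thesis using descent_one_asymptotics[of k1 K k2 L] k L[OF k(1)] by (simp add: m_def)
  next
    case False
    then have "L k1 - j \<le> m" "m \<noteq> L k1 - j" "j \<le> L k1" using j le l by (auto simp: m_def)
    then show ?thesis using False descent_asymptotics[of j "L k1" m] by simp
  qed
  let ?D_lim = "if k1 \<in> K_star K L k2 then 1 / real (L_star K L k2) else 0"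
  let ?U_lim = "real (card (K_star K L k2)) / real (L k2)"
  have U_sum: "((\<lambda>\<nu>. \<Sum>j\<in>{0..<l2}. ascent (excursion_rate K L k2 \<nu>) (L k2) \<nu> j / \<nu> ^ m) \<longlongrightarrow>
      (\<Sum>j\<in>{0..<l2}. if j = 0 then ?U_lim else 0)) at_top"
    unfolding m_def by (rule tendsto_sum) (rule ascent_asymptotics[OF L k(2)])
  have D_sum: "((\<lambda>\<nu>. \<Sum>j\<in>{0<..l1}. descent (L k1) \<nu> j / \<nu> ^ m) \<longlongrightarrow>
      (\<Sum>j\<in>{0<..l1}. if j = 1 then ?D_lim else 0)) at_top"
    by (rule tendsto_sum) (rule D)
  have U_val: "(\<Sum>j\<in>{0..<l2}. if j = 0 then ?U_lim else 0) = ?U_lim"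
    using l by (subst sum.delta) auto
  have D_val: "(\<Sum>j\<in>{0<..l1}. if j = 1 then ?D_lim else 0) =
      (if k1 \<in> K_star K L k2 then 1 else 0) / real (L_star K L k2)"
    using l by (subst sum.delta) auto
  have split: "branch_time K L k2 l2 \<nu> k1 l1 / \<nu> ^ m =
      (\<Sum>j\<in>{0<..l1}. descent (L k1) \<nu> j / \<nu> ^ m) +
      (\<Sum>j\<in>{0..<l2}. ascent (excursion_rate K L k2 \<nu>) (L k2) \<nu> j / \<nu> ^ m)" for \<nu>
    using k(3) by (simp add: branch_time_def sum_divide_distrib add_divide_distrib)
  show ?thesis
    unfolding m_def[symmetric] split
    by (rule tendsto_add[OF D_sum[unfolded D_val] U_sum[unfolded U_val]])
qed

theorem mainTheorem3:
  fixes K :: nat and L :: "nat \<Rightarrow> nat" and k1 k2 l1 l2 :: nat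
    and M :: "real \<Rightarrow> 'w measure" and X :: "real \<Rightarrow> real \<Rightarrow> 'w \<Rightarrow> state"
  assumes "K \<ge> 2"
    and "\<And>k. k \<in> {1..K} \<Longrightarrow> L k \<ge> 1"
    and "k1 \<in> {1..K}" and "k2 \<in> {1..K}" and "k1 \<noteq> k2"
    and "0 < l1" and "l1 \<le> L k1" and "0 < l2" and "l2 \<le> L k2"
    and "\<And>\<nu>. \<nu> > 0 \<Longrightarrow>
           markov_process (M \<nu>) (state_space K L) (rate L \<nu>) (Active k1 l1) (X \<nu>)"
  shows "((\<lambda>\<nu>. mean_first_passage_time (M \<nu>) (X \<nu>) (Active k2 l2) /
            ennreal (((if k1 \<in> K_star K L k2 then 1 else 0) / real (L_star K L k2)
                       + real (card (K_star K L k2)) / real (L k2))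
                     * \<nu> ^ (L_star K L k2 - 1)))
          \<longlongrightarrow> 1) at_top"
proof -
  define m where "m = L_star K L k2 - 1"
  define c where "c = (if k1 \<in> K_star K L k2 then 1 else 0) / real (L_star K L k2)
                       + real (card (K_star K L k2)) / real (L k2)"
  define b where "b \<nu> = branch_time K L k2 l2 \<nu> k1 l1" for \<nu>
  note L = assms(2)
  have S: "Active k1 l1 \<in> state_space K L" "Active k2 l2 \<in> state_space K L"
    using assms(3-9) by (auto simp: state_space_def)
  have "L_star K L k2 \<in> L ` ({1..K} - {k2})"
    unfolding L_star_def using assms(3,5) by (intro Max_in) auto
  then have "K_star K L k2 \<noteq> {}" by (auto simp: K_star_def)
  moreover have "finite (K_star K L k2)" by (simp add: K_star_def)
  ultimately have c: "0 < c"
    unfolding c_def using L[OF assms(4)] by (intro add_nonneg_pos divide_pos_pos) (auto simp: card_gt_0_iff)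
  have "((\<lambda>\<nu>. b \<nu> / \<nu> ^ m / c) \<longlongrightarrow> c / c) at_top"
    unfolding b_def m_def
    by (intro tendsto_divide tendsto_const branch_time_asymptotics[of K L k1 k2 l1 l2, folded c_def])
      (use assms c in auto)
  then have "((\<lambda>\<nu>. ennreal (b \<nu> / \<nu> ^ m / c)) \<longlongrightarrow> 1) at_top"
    using tendsto_ennrealI c by fastforce
  moreover have "\<forall>\<^sub>F \<nu> in at_top. ennreal (b \<nu> / \<nu> ^ m / c) =
      mean_first_passage_time (M \<nu>) (X \<nu>) (Active k2 l2) / ennreal (c * \<nu> ^ m)"
    using eventually_gt_at_top[of 0]
  proof eventually_elim
    case (elim \<nu>)
    have "mean_first_passage_time (M \<nu>) (X \<nu>) (Active k2 l2) = ennreal (b \<nu>)"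
      unfolding b_def by (rule mean_first_passage_time_star[OF L elim S assms(5) assms(10)[OF elim]])
    moreover have "0 \<le> b \<nu>" unfolding b_def using elim assms(9) by (rule branch_time_nonneg)
    ultimately show ?case using elim c by (simp add: divide_ennreal field_simps)
  qed
  ultimately show ?thesis
    unfolding c_def m_def by (rule Lim_transform_eventually)
qed

end
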